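(* Suppose $\operatorname{rank}(C)=N_2$ and $|\operatorname{supp}(s_i)|=N_2$ for every $s_i\in\mathcal S$, that $d(\xi,x_1)$ is affine in $\xi$, and that $\Xi$ is polyhedral. Let $x_1^*$ be the optimal first-stage decision certified by Algorithm EPG-O, and let $\mathcal S_{\mathrm{val}}$ be the set returned by Algorithm EPG-V at $x_1^*$, run with $\varepsilon_{\mathrm{aud}}=0$ and with every audit and every recourse-dual linear program solved exactly (so that $\max_{s\in\mathcal S_{\mathrm{val}}}d(\xi,x_1^* )^\top s=\psi(x_1^*,\xi)$ for all $\xi\in\Xi$). If $K\ge|\mathcal S_{\mathrm{val}}|$, then the $K$-adaptability affine decision rule formulation $$\min_{x_1,\,x_2^1(\cdot),\dots,x_2^K(\cdot)}\ c^\top x_1+\sup_{\mathbb P\in\mathcal P}\mathbb E_{\mathbb P}\big[\psi_K(x_1,\{x_2^k(\xi)\}_{k=1}^K,\xi)\big]\quad\text{s.t.}\quad Ax_1\ge a,\quad x_2^k:\Xi\to\mathbb R^{N_2}\ \text{affine},\ k=1,\dots,K,$$ where $\psi_K(x_1,\{x_2^k(\xi)\}_{k=1}^K,\xi)=\min_{k\in[K]}\{b^\top x_2^k(\xi)\mid Cx_2^k(\xi)\ge d(\xi,x_1)\}$ (equal to $+\infty$ if no $k$ is feasible), solves the full master problem exactly, i.e. its optimal value equals that of the full master problem and is attained.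
   Context: Setting. $\Xi\subseteq\mathbb R^{N_\xi}$ is a compact uncertainty set, $\mathcal P$ is a set of probability measures supported on $\Xi$ (the ambiguity set), $C\in\mathbb R^{M\times N_2}$ with $M\ge N_2$, $b\in\mathbb R^{N_2}$, and $B,W,w,A,a,c$ are fixed data of compatible dimensions; $x_1\in\mathbb R^{N_1}$, $x_2\in\mathbb R^{N_2}$. Put $d(\xi,x_1)=W\xi+w-Bx_1\in\mathbb R^M$. The recourse value is $\psi(x_1,\xi)=\min_{x_2}\{b^\top x_2\mid Cx_2\ge d(\xi,x_1)\}$ ($+\infty$ if infeasible). The dual polyhedron $\mathcal Z=\{z\in\mathbb R^M\mid C^\top z=b,\ z\ge 0\}$ is assumed nonempty; $\mathcal S=\{s_1,\dots,s_S\}$ is its finite set of extreme points (vertices), and $\mathcal R$ is the finite set of extreme rays of its recession cone. The first-stage feasible region is $$\mathcal X_1=\{x_1: Ax_1\ge a,\ \sup_{\xi\in\Xi}d(\xi,x_1)^\top r\le 0\ \ \forall r\in\mathcal R\}.$$ $\Theta\subseteq\mathbb R^{N_\theta}$, $\phi_0:\Theta\to\mathbb R$ and $\phi_\ell:\Theta\times\Xi\to\mathbb R$ ($\ell\in[L]$) are determined by $\mathcal P$. The full master problem is $$\min_{x_1\in\mathcal X_1,\theta\in\Theta}\ c^\top x_1+\phi_0(\theta)\quad\text{s.t.}\quad \phi_\ell(\theta,\xi)\ge d(\xi,x_1)^\top s\ \ \forall\xi\in\Xi,\ s\in\mathcal S,\ \ell\in[L].$$ Standing assumptions: the two-stage distributionally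 robust problem $\min_{x_1:Ax_1\ge a}c^\top x_1+\sup_{\mathbb P\in\mathcal P}\mathbb E_{\mathbb P}[\psi(x_1,\xi)]$ has a finite, attained optimal value, and the full master problem is an exact reformulation of it (same optimal value and same optimal first-stage decisions). $\operatorname{supp}(v)$ is the index set of nonzero components; $v_{\mathcal J}$ and $C_{\mathcal J}$ are the subvector and row submatrix indexed by $\mathcal J$; $C_k$ is the $k$-th row of $C$. Algorithm EPG-O. The RMP for $\mathcal S_t\subseteq\mathcal S$ is the full master with $\mathcal S$ replaced by $\mathcal S_t$. Exact separation at $(x_1^{(t)},\theta^{(t)})$ computes $V^{(t)}=\max_{\ell\in[L]}\max_{\xi\in\Xi,z\in\mathcal Z}[d(\xi,x_1^{(t)})^\top z-\phi_\ell(\theta^{(t)},\xi)]$; approximate separation computes $V'^{(t)}$ by the same formula with $\Xi$ replaced by a finite set $\Xi^{(t)}\subseteq\Xi$ of candidate worst-case scenarios from the current RMP. Input: a nonempty seed $\mathcal S_1\subseteq\mathcal S$ and tolerances $\varepsilon_{\mathrm{disc}},\varepsilon_{\mathrm{obj}}\ge0$. Starting from $t=1$, repeat: solve the RMP for $\mathcal S_t$ to get $(x_1^{(t)},\theta^{(t)})$; solve approximate separation, obtaining a maximizing vertex $\hat s^{(t)}$; if $V'^{(t)}>\varepsilon_{\mathrm{disc}}$ set $s^\star=\hat s^{(t)}$; otherwise solve exact separation, obtaining a maximizing vertex $s^\star$, and if $V^{(t)}\le\varepsilon_{\mathrm{obj}}$, delete vertices from $\mathcal S_t$ until no further deletion preserves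 the RMP value, giving $\mathcal S_{\mathrm{obj}}$, return $(x_1^{(t)},\theta^{(t)},\mathcal S_{\mathrm{obj}})$ and stop; finally set $\mathcal S_{t+1}=\mathcal S_t\cup\{s^\star\}$, $t\leftarrow t+1$. "Certified by EPG-O" means returned as the $x_1$-component of the output with $\varepsilon_{\mathrm{obj}}=0$ and all problems solved exactly, so that $(x_1^*,\theta^* )$ is optimal for the full master problem for some $\theta^*$. Algorithm EPG-V (at the fixed decision $x_1^*$). For $s_i\in\mathcal S$ let $\mathcal J_i=\operatorname{supp}(s_i)$ and $x_{2,i}(\xi)=C_{\mathcal J_i}^{-1}d_{\mathcal J_i}(\xi,x_1^* )$. For nonempty $\mathcal T\subseteq\mathcal S$ and $s_i\in\mathcal T$, the dominance cell is $$\widehat{\mathcal R}_i(\mathcal T)=\{\xi\in\Xi:\ d(\xi,x_1^* )^\top s_i\ge d(\xi,x_1^* )^\top s_j\ \ \forall s_j\in\mathcal T\},$$ and for each nonempty cell and each $k\in[M]\setminus\mathcal J_i$ the audit is $$\Delta_{ik}(\mathcal T)=\max_{\xi\in\widehat{\mathcal R}_i(\mathcal T)}\{d_k(\xi,x_1^* )-C_kx_{2,i}(\xi)\}.$$ Input: $x_1^*$, a nonempty EPG-O output set $\mathcal S'\subseteq\mathcal S$, and $\varepsilon_{\mathrm{aud}}\ge0$. Initialize $\mathcal S_{\mathrm{val}}=\mathcal S'$ and solve all audits for nonempty cells. While some $\Delta_{ik}(\mathcal S_{\mathrm{val}})>\varepsilon_{\mathrm{aud}}$: choose such a pair $(i,k)$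 and a maximizing witness $\hat\xi\in\widehat{\mathcal R}_i(\mathcal S_{\mathrm{val}})$; solve the recourse-dual linear program $\max_{z\in\mathcal Z}d(\hat\xi,x_1^* )^\top z$ to obtain an optimal extreme point $s^{\mathrm{new}}\in\mathcal S$; replace $\mathcal S_{\mathrm{val}}$ by $\mathcal S_{\mathrm{val}}\cup\{s^{\mathrm{new}}\}$; recompute all nonempty cells and audits. After the loop, prune $\mathcal S_{\mathrm{val}}$ by deleting the extreme points whose dominance cell $\widehat{\mathcal R}_i(\mathcal S_{\mathrm{val}})$ has empty relative interior in $\Xi$ (empty interior in the subspace topology of $\Xi$), and return $\mathcal S_{\mathrm{val}}$. *)

theory Defs
  imports "HOL-Analysis.Analysis" "HOL-Probability.Probability"
begin

text \<open>
  The index types are \<open>'x\<close> for the uncertainty, \<open>'n1\<close> and \<open>'n2\<close> for the two decision stages,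
  \<open>'m\<close> for the recourse constraints, \<open>'p\<close> for the first-stage constraints and \<open>'t\<close> for
  \<open>\<theta>\<close>. The family \<open>\<phi>\<^sub>1, \<dots>, \<phi>\<^sub>L\<close> is \<open>phi D l\<close> for \<open>l \<in> {1..nphi D}\<close>; the values of
  \<open>phi0 D\<close> and \<open>phi D l\<close> outside \<open>Theta D\<close> and \<open>Theta D \<times> uset D\<close> are never used.
\<close>

record ('x, 'n1, 'n2, 'm, 'p, 't) dro_data =
  uset  :: "(real ^ ('x::finite)) set"
  ambig :: "(real ^ 'x) measure set"
  Cmat  :: "real ^ ('n2::finite) ^ ('m::finite)"
  bvec  :: "real ^ 'n2"
  Wmat  :: "real ^ 'x ^ 'm"
  wvec  :: "real ^ 'm"
  Bmat  :: "real ^ ('n1::finite) ^ 'm"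
  Amat  :: "real ^ 'n1 ^ ('p::finite)"
  avec  :: "real ^ 'p"
  cvec  :: "real ^ 'n1"
  Theta :: "(real ^ ('t::finite)) set"
  phi0  :: "real ^ 't \<Rightarrow> real"
  nphi  :: nat
  phi   :: "nat \<Rightarrow> real ^ 't \<Rightarrow> real ^ 'x \<Rightarrow> real"

definition dvec where
  "dvec D x1 \<xi> = Wmat D *v \<xi> + wvec D - Bmat D *v x1"

definition affine_map_on :: "(real ^ 'x) set \<Rightarrow> (real ^ 'x \<Rightarrow> real ^ 'n) \<Rightarrow> bool" where
  "affine_map_on X f \<longleftrightarrow> (\<exists>(Y :: real ^ 'x ^ 'n) y. \<forall>\<xi>\<in>X. f \<xi> = Y *v \<xi> + y)"

definition prob_supported_on :: "(real ^ 'x) set \<Rightarrow> (real ^ 'x) measure \<Rightarrow> bool" where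
  "prob_supported_on X P \<longleftrightarrow> prob_space P \<and> sets P = sets borel \<and> measure P X = 1"

text \<open>
  Expectation of an extended-real function, \<open>E[f\<^sup>+] - E[f\<^sup>-]\<close>. When \<open>dual_poly D \<noteq> {}\<close> (below) and
  \<open>uset D\<close> is compact, weak duality bounds the recourse costs below on \<open>uset D\<close>, so that
  \<open>\<infinity> - \<infinity>\<close> does not occur for them.
\<close>

definition ereal_expectation :: "'a measure \<Rightarrow> ('a \<Rightarrow> ereal) \<Rightarrow> ereal" where
  "ereal_expectation P f =
     enn2ereal (\<integral>\<^sup>+ \<xi>. e2ennreal (f \<xi>) \<partial>P) - enn2ereal (\<integral>\<^sup>+ \<xi>. e2ennreal (- f \<xi>) \<partial>P)"

definition recourse :: "('x::finite, 'n1::finite, 'n2::finite, 'm::finite, 'p::finite, 't::finite) dro_data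
    \<Rightarrow> real ^ 'n1 \<Rightarrow> real ^ 'x \<Rightarrow> ereal" where
  "recourse D x1 \<xi> = (INF x2 \<in> {x2. Cmat D *v x2 \<ge> dvec D x1 \<xi>}. ereal (bvec D \<bullet> x2))"

definition first_stage :: "('x::finite, 'n1::finite, 'n2::finite, 'm::finite, 'p::finite, 't::finite) dro_data
    \<Rightarrow> (real ^ 'n1) set" where
  "first_stage D = {x1. Amat D *v x1 \<ge> avec D}"

definition two_stage_cost where
  "two_stage_cost D x1 =
     ereal (cvec D \<bullet> x1) + (SUP P \<in> ambig D. ereal_expectation P (recourse D x1))"

definition two_stage_value where
  "two_stage_value D = (INF x1 \<in> first_stage D. two_stage_cost D x1)"

definition two_stage_optimal where
  "two_stage_optimal D x1 \<longleftrightarrow> is_arg_min (two_stage_cost D) (\<lambda>x. x \<in> first_stage D) x1"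

definition dual_poly :: "('x::finite, 'n1::finite, 'n2::finite, 'm::finite, 'p::finite, 't::finite) dro_data
    \<Rightarrow> (real ^ 'm) set" where
  "dual_poly D = {z. transpose (Cmat D) *v z = bvec D \<and> z \<ge> 0}"

definition dual_vertices where
  "dual_vertices D = {s. s extreme_point_of dual_poly D}"

definition recession_cone :: "'a::real_vector set \<Rightarrow> 'a set" where
  "recession_cone S = {r. \<forall>z\<in>S. \<forall>\<alpha>\<ge>0. z + \<alpha> *\<^sub>R r \<in> S}"

text \<open>Each extreme ray is represented by its generator of norm 1.\<close>

definition dual_rays where
  "dual_rays D = {r. norm r = 1 \<and> (\<lambda>\<alpha>. \<alpha> *\<^sub>R r) ` {0..} face_of recession_cone (dual_poly D)}"

definition X1set where
  "X1set D = {x1 \<in> first_stage D.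
     \<forall>r\<in>dual_rays D. (SUP \<xi> \<in> uset D. ereal (dvec D x1 \<xi> \<bullet> r)) \<le> 0}"

text \<open>The master problem over a vertex set \<open>T\<close>; the full master problem is \<open>T = dual_vertices D\<close>.\<close>

definition master_feasible where
  "master_feasible D T = {(x1, \<theta>). x1 \<in> X1set D \<and> \<theta> \<in> Theta D \<and>
     (\<forall>\<xi>\<in>uset D. \<forall>s\<in>T. \<forall>l\<in>{1..nphi D}. phi D l \<theta> \<xi> \<ge> dvec D x1 \<xi> \<bullet> s)}"

definition master_obj :: "('x::finite, 'n1::finite, 'n2::finite, 'm::finite, 'p::finite, 't::finite) dro_data
    \<Rightarrow> (real ^ 'n1) \<times> (real ^ 't) \<Rightarrow> real" where
  "master_obj D y = cvec D \<bullet> fst y + phi0 D (snd y)"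

definition master_value where
  "master_value D T = (INF y \<in> master_feasible D T. ereal (master_obj D y))"

definition master_optimal where
  "master_optimal D T y \<longleftrightarrow> is_arg_min (master_obj D) (\<lambda>y. y \<in> master_feasible D T) y"

definition exact_reformulation where
  "exact_reformulation D \<longleftrightarrow>
     master_value D (dual_vertices D) = two_stage_value D \<and>
     {x1. \<exists>\<theta>. master_optimal D (dual_vertices D) (x1, \<theta>)} = {x1. two_stage_optimal D x1}"

text \<open>
  EPG-O: \<open>V\<close> is the maximum (required to be attained) of the separation problem over the
  scenarios \<open>X\<close>, and \<open>s\<close> a maximizing vertex. \<open>X = uset D\<close> is exact separation.
\<close>

definition separation where
  "separation D X x1 \<theta> V s \<longleftrightarrow> s \<in> dual_vertices D \<and>
     (\<exists>l\<in>{1..nphi D}. \<exists>\<xi>\<in>X. dvec D x1 \<xi> \<bullet> s - phi D l \<theta> \<xi> = V) \<and>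
     (\<forall>l\<in>{1..nphi D}. \<forall>\<xi>\<in>X. \<forall>z\<in>dual_poly D. dvec D x1 \<xi> \<bullet> z - phi D l \<theta> \<xi> \<le> V)"

text \<open>
  \<open>epgo_step\<close> covers the passes that do not stop; the stopping pass is part of \<open>epgo_output\<close>.
  The choices of optimal solutions and of the finite candidate
  set \<open>X\<close> are nondeterministic.
\<close>

inductive epgo_step for D and \<epsilon>disc \<epsilon>obj :: real where
  approx: "master_optimal D T (x1, \<theta>) \<Longrightarrow> finite X \<Longrightarrow> X \<subseteq> uset D \<Longrightarrow>
    separation D X x1 \<theta> V' s \<Longrightarrow> V' > \<epsilon>disc \<Longrightarrow>
    epgo_step D \<epsilon>disc \<epsilon>obj T (insert s T)"
| exact: "master_optimal D T (x1, \<theta>) \<Longrightarrow> finite X \<Longrightarrow> X \<subseteq> uset D \<Longrightarrow>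
    separation D X x1 \<theta> V' s' \<Longrightarrow> V' \<le> \<epsilon>disc \<Longrightarrow>
    separation D (uset D) x1 \<theta> V s \<Longrightarrow> V > \<epsilon>obj \<Longrightarrow>
    epgo_step D \<epsilon>disc \<epsilon>obj T (insert s T)"

inductive epgo_delete for D where
  "s \<in> T \<Longrightarrow> master_value D (T - {s}) = master_value D T \<Longrightarrow> epgo_delete D T (T - {s})"

definition epgo_output where
  "epgo_output D \<epsilon>disc \<epsilon>obj x1 \<theta> Sobj \<longleftrightarrow>
     (\<exists>S1 T X V' s' V s.
        S1 \<noteq> {} \<and> S1 \<subseteq> dual_vertices D \<and> (epgo_step D \<epsilon>disc \<epsilon>obj)\<^sup>*\<^sup>* S1 T \<and>
        master_optimal D T (x1, \<theta>) \<and>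
        finite X \<and> X \<subseteq> uset D \<and> separation D X x1 \<theta> V' s' \<and> V' \<le> \<epsilon>disc \<and>
        separation D (uset D) x1 \<theta> V s \<and> V \<le> \<epsilon>obj \<and>
        (epgo_delete D)\<^sup>*\<^sup>* T Sobj \<and> \<not> (\<exists>T'. epgo_delete D Sobj T'))"

definition supp :: "real ^ 'm \<Rightarrow> 'm set" where
  "supp v = {k. v $ k \<noteq> 0}"

text \<open>
  \<open>C\<^sub>J\<inverse> d\<^sub>J\<close> for \<open>J = supp s\<close> with \<open>card J = CARD('n2)\<close>: the rows in \<open>J\<close> are listed along a
  bijection from \<open>'n2\<close>, so that \<open>C\<^sub>J\<close> is a square matrix; the product does not depend on the
  bijection. This is the policy \<open>x\<^sub>2\<^sub>,\<^sub>i\<close> audited by EPG-V.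
\<close>

definition row_list :: "'m set \<Rightarrow> 'n2 \<Rightarrow> 'm" where
  "row_list J = (SOME e. bij_betw e UNIV J)"

definition vertex_policy :: "('x::finite, 'n1::finite, 'n2::finite, 'm::finite, 'p::finite, 't::finite) dro_data
    \<Rightarrow> real ^ 'n1 \<Rightarrow> real ^ 'm \<Rightarrow> real ^ 'x \<Rightarrow> real ^ 'n2" where
  "vertex_policy D x1 s \<xi> =
     (let e = row_list (supp s) :: 'n2 \<Rightarrow> 'm
      in matrix_inv (\<chi> i. Cmat D $ e i) *v (\<chi> i. dvec D x1 \<xi> $ e i))"

definition cell where
  "cell D x1 T s = {\<xi> \<in> uset D. \<forall>s'\<in>T. dvec D x1 \<xi> \<bullet> s \<ge> dvec D x1 \<xi> \<bullet> s'}"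

definition violation where
  "violation D x1 s k \<xi> = dvec D x1 \<xi> $ k - Cmat D $ k \<bullet> vertex_policy D x1 s \<xi>"

definition audit where
  "audit D x1 T s k = (SUP \<xi> \<in> cell D x1 T s. violation D x1 s k \<xi>)"

definition audit_fails :: "('x::finite, 'n1::finite, 'n2::finite, 'm::finite, 'p::finite, 't::finite) dro_data
    \<Rightarrow> real ^ 'n1 \<Rightarrow> real \<Rightarrow> (real ^ 'm) set \<Rightarrow> real ^ 'm \<Rightarrow> 'm \<Rightarrow> bool" where
  "audit_fails D x1 \<epsilon>aud T s k \<longleftrightarrow>
     s \<in> T \<and> cell D x1 T s \<noteq> {} \<and> k \<notin> supp s \<and> audit D x1 T s k > \<epsilon>aud"

inductive epgv_step for D x1 \<epsilon>aud where
  "audit_fails D x1 \<epsilon>aud T s k \<Longrightarrow>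
   \<xi> \<in> cell D x1 T s \<Longrightarrow> violation D x1 s k \<xi> = audit D x1 T s k \<Longrightarrow>
   snew \<in> dual_vertices D \<Longrightarrow>
   is_arg_max (\<lambda>z. dvec D x1 \<xi> \<bullet> z) (\<lambda>z. z \<in> dual_poly D) snew \<Longrightarrow>
   epgv_step D x1 \<epsilon>aud T (insert snew T)"

definition epgv_prune where
  "epgv_prune D x1 T = {s \<in> T. (top_of_set (uset D)) interior_of (cell D x1 T s) \<noteq> {}}"

definition epgv_output where
  "epgv_output D x1 \<epsilon>aud S' Sval \<longleftrightarrow>
     (\<exists>T. (epgv_step D x1 \<epsilon>aud)\<^sup>*\<^sup>* S' T \<and> (\<forall>s k. \<not> audit_fails D x1 \<epsilon>aud T s k) \<and>
          Sval = epgv_prune D x1 T)"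

definition recourse_K :: "('x::finite, 'n1::finite, 'n2::finite, 'm::finite, 'p::finite, 't::finite) dro_data
    \<Rightarrow> nat \<Rightarrow> real ^ 'n1 \<Rightarrow> (nat \<Rightarrow> real ^ 'x \<Rightarrow> real ^ 'n2) \<Rightarrow> real ^ 'x \<Rightarrow> ereal" where
  "recourse_K D K x1 x2 \<xi> =
     (INF k \<in> {k \<in> {1..K}. Cmat D *v x2 k \<xi> \<ge> dvec D x1 \<xi>}. ereal (bvec D \<bullet> x2 k \<xi>))"

definition K_adapt_feasible where
  "K_adapt_feasible D K = {(x1, x2). x1 \<in> first_stage D \<and> (\<forall>k\<in>{1..K}. affine_map_on (uset D) (x2 k))}"

definition K_adapt_cost :: "('x::finite, 'n1::finite, 'n2::finite, 'm::finite, 'p::finite, 't::finite) dro_data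
    \<Rightarrow> nat \<Rightarrow> (real ^ 'n1) \<times> (nat \<Rightarrow> real ^ 'x \<Rightarrow> real ^ 'n2) \<Rightarrow> ereal" where
  "K_adapt_cost D K y =
     ereal (cvec D \<bullet> fst y) + (SUP P \<in> ambig D. ereal_expectation P (recourse_K D K (fst y) (snd y)))"

definition K_adapt_value where
  "K_adapt_value D K = (INF y \<in> K_adapt_feasible D K. K_adapt_cost D K y)"

definition K_adapt_optimal where
  "K_adapt_optimal D K y \<longleftrightarrow> is_arg_min (K_adapt_cost D K) (\<lambda>y. y \<in> K_adapt_feasible D K) y"

end

theory Submission
  imports Defs
begin

text \<open>
  The rules that count in the minimum defining \<open>\<psi>\<^sub>K\<close> are feasible recourse decisions, so the
  \<open>K\<close>-adaptability cost never falls below the two-stage cost (\<open>two_stage_value_le_K_adapt_cost\<close>),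
  and the optimal value of the two-stage problem is that of the full master problem because the
  master is an exact reformulation. It remains to exhibit rules that attain this bound.

  The decision \<open>x\<^sub>1\<^sup>*\<close> is optimal for a master problem over fewer vertices, hence for a relaxation,
  and exact separation found no violated constraint, so it is optimal for the full master and
  therefore for the two-stage problem (\<open>epgo_certified_optimal\<close>).

  At \<open>x\<^sub>1\<^sup>*\<close> the rules are the basic solutions \<open>x\<^sub>2\<^sub>,\<^sub>i(\<xi>)\<close>. An extreme point of \<open>{z. C\<^sup>T z = b, z \<ge> 0}\<close>
  has linearly independent rows of \<open>C\<close> on its support \<open>J\<close>; with exactly \<open>N\<^sub>2\<close> nonzero components the
  matrix \<open>C\<^sub>J\<close> is thus invertible, and \<open>x\<^sub>2\<^sub>,\<^sub>i\<close> is an affine map that meets the constraints in \<open>J\<close> with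
  equality. Complementary slackness then gives \<open>b \<bullet> x\<^sub>2\<^sub>,\<^sub>i(\<xi>) = d(\<xi>) \<bullet> s\<^sub>i\<close>, which by weak duality is a
  lower bound of the recourse value: the rule is optimal wherever it is feasible
  (\<open>vertex_policy_optimal\<close>). Termination of EPG-V with tolerance zero says that the constraints
  outside \<open>J\<close> hold as well on the whole dominance cell of \<open>s\<^sub>i\<close> (\<open>vertex_policy_feasible_on_cell\<close>).

  The cells of all vertices present at termination cover \<open>\<Xi>\<close>, since a finite set of numbers has a
  maximum. Pruning does not destroy the cover: finitely many closed sets with empty interior have a
  union with empty interior, while the points missed by the retained cells form an open set inside
  that union (\<open>finite_closed_cover_by_fat_sets\<close>). Hence the rules of the retained vertices reproduce
  the recourse value at every scenario, and there are at most \<open>K\<close> of them.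
\<close>

section \<open>Extreme points of standard-form polyhedra\<close>

text \<open>
  A kernel vector supported where \<open>z\<close> is positive can be added to and subtracted from \<open>z\<close> in small
  multiples without leaving the polyhedron, which makes \<open>z\<close> a midpoint.
\<close>

lemma extreme_point_kernel_trivial:
  fixes A :: "real ^ 'm ^ 'n" and z y :: "real ^ ('m::finite)"
  assumes ext: "z extreme_point_of {z. A *v z = b \<and> z \<ge> 0}"
    and ker: "A *v y = 0" and sub: "supp y \<subseteq> supp z"
  shows "y = 0"
proof (rule ccontr)
  assume "y \<noteq> 0"
  have Az: "A *v z = b" and z0: "\<And>k. 0 \<le> z $ k"
    using ext by (auto simp: extreme_point_of_def less_eq_vec_def)
  \<comment> \<open>The step keeps every positive component nonnegative in both directions; the summand 1 avoids a
    division by zero, and the element 1 keeps the minimum positive when the support is empty.\<close>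
  define e where "e = Min (insert 1 ((\<lambda>k. z $ k / (1 + \<bar>y $ k\<bar>)) ` supp z))"
  have "0 < z $ k / (1 + \<bar>y $ k\<bar>)" if "k \<in> supp z" for k
    using z0[of k] that by (simp add: supp_def less_le add_nonneg_eq_0_iff)
  then have "e > 0"
    by (auto simp: e_def)
  have bound: "e * \<bar>y $ k\<bar> \<le> z $ k" for k
  proof (cases "k \<in> supp z")
    case True
    then have "e \<le> z $ k / (1 + \<bar>y $ k\<bar>)"
      by (auto simp: e_def)
    then have "e * (1 + \<bar>y $ k\<bar>) \<le> z $ k"
      by (simp add: pos_le_divide_eq)
    with \<open>e > 0\<close> show ?thesis
      by (simp add: distrib_left)
  next
    case False
    then have "k \<notin> supp y"
      using sub by blast
    with z0 show ?thesis
      by (simp add: supp_def)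
  qed
  have mem: "z + c *\<^sub>R y \<in> {z. A *v z = b \<and> z \<ge> 0}" if "\<bar>c\<bar> = e" for c
  proof -
    have "0 \<le> z $ k + c * y $ k" for k
    proof -
      have "\<bar>c * y $ k\<bar> \<le> z $ k"
        using bound[of k] that by (simp add: abs_mult)
      then show ?thesis
        by linarith
    qed
    then show ?thesis
      using Az ker by (simp add: matrix_vector_right_distrib matrix_vector_mult_scaleR less_eq_vec_def)
  qed
  have "z + e *\<^sub>R y \<noteq> z + (- e) *\<^sub>R y"
    using \<open>y \<noteq> 0\<close> \<open>e > 0\<close> by (simp only: add_left_cancel scaleR_cancel_right) simp
  moreover have "midpoint (z + e *\<^sub>R y) (z + (- e) *\<^sub>R y) = z"
    by (simp add: midpoint_def flip: scaleR_2)
  ultimately have "z \<in> open_segment (z + e *\<^sub>R y) (z + (- e) *\<^sub>R y)"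
    by (metis midpoint_in_open_segment)
  then show False
    using ext mem[of e] mem[of "- e"] \<open>e > 0\<close> by (auto simp: extreme_point_of_def)
qed

text \<open>Two extreme points with the same support differ by such a kernel vector.\<close>

lemma finite_extreme_points_standard_form:
  fixes A :: "real ^ ('m::finite) ^ 'n"
  shows "finite {z. z extreme_point_of {z. A *v z = b \<and> z \<ge> 0}}" (is "finite ?E")
proof (rule inj_on_finite)
  show "inj_on supp ?E"
  proof (rule inj_onI)
    fix u v assume uv: "u \<in> ?E" "v \<in> ?E" and eq: "supp u = supp v"
    have "A *v (u - v) = 0"
      using uv by (auto simp: extreme_point_of_def matrix_vector_mult_diff_distrib)
    moreover have "supp (u - v) \<subseteq> supp u"
      using eq by (auto simp: supp_def set_eq_iff)
    ultimately have "u - v = 0"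
      using extreme_point_kernel_trivial uv(1) by blast
    then show "u = v"
      by simp
  qed
qed auto

section \<open>Vertex policies\<close>

lemma finite_dual_vertices: "finite (dual_vertices D)"
  unfolding dual_vertices_def dual_poly_def by (rule finite_extreme_points_standard_form)

lemma matrix_inv_right_inverse: "invertible A \<Longrightarrow> A ** matrix_inv A = mat 1"
  unfolding invertible_def matrix_inv_def by (rule someI2_ex) auto

lemma bij_betw_row_list:
  fixes J :: "'m::finite set"
  assumes "card J = CARD('n2::finite)"
  shows "bij_betw (row_list J :: 'n2 \<Rightarrow> 'm) UNIV J"
proof -
  have "\<exists>e :: 'n2 \<Rightarrow> 'm. bij_betw e UNIV J"
    using assms by (intro finite_same_card_bij) auto
  then show ?thesis
    unfolding row_list_def by (rule someI_ex)
qed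

text \<open>
  A vector in the kernel of \<open>C\<^sub>J\<^sup>T\<close>, extended by zero outside \<open>J\<close>, lies in the kernel of \<open>C\<^sup>T\<close> and is
  supported on the support of the vertex.
\<close>

lemma invertible_vertex_basis:
  fixes D :: "('x::finite, 'n1::finite, 'n2::finite, 'm::finite, 'p::finite, 't::finite) dro_data"
  assumes s: "s \<in> dual_vertices D" and card: "card (supp s) = CARD('n2)"
  shows "invertible ((\<chi> i. Cmat D $ row_list (supp s) i) :: real ^ 'n2 ^ 'n2)" (is "invertible ?M")
proof -
  let ?e = "row_list (supp s) :: 'n2 \<Rightarrow> 'm"
  have bij: "bij_betw ?e UNIV (supp s)"
    by (rule bij_betw_row_list[OF card])
  then have inj: "inj ?e"
    by (rule bij_betw_imp_inj_on)
  have "v = 0" if v: "transpose ?M *v v = 0" for v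
  proof -
    define y :: "real ^ 'm" where "y = (\<chi> k. if k \<in> supp s then v $ inv ?e k else 0)"
    have ye: "y $ ?e i = v $ i" for i
      using bij inj by (auto simp: y_def bij_betw_def)
    have "(transpose (Cmat D) *v y) $ j = (transpose ?M *v v) $ j" for j
    proof -
      have "(transpose (Cmat D) *v y) $ j = (\<Sum>k\<in>UNIV. Cmat D $ k $ j * y $ k)"
        by (simp add: matrix_vector_mult_def transpose_def del: transpose_matrix_vector)
      also have "\<dots> = (\<Sum>k\<in>supp s. Cmat D $ k $ j * y $ k)"
        by (intro sum.mono_neutral_right) (auto simp: y_def)
      also have "\<dots> = (\<Sum>i\<in>UNIV. Cmat D $ ?e i $ j * y $ ?e i)"
        by (rule sum.reindex_bij_betw[OF bij, symmetric])
      also have "\<dots> = (transpose ?M *v v) $ j"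
        by (simp add: ye matrix_vector_mult_def transpose_def del: transpose_matrix_vector)
      finally show ?thesis .
    qed
    then have "transpose (Cmat D) *v y = 0"
      using v by (simp add: vec_eq_iff del: transpose_matrix_vector)
    moreover have "supp y \<subseteq> supp s"
      by (auto simp: y_def supp_def[of "vec_lambda _"])
    ultimately have "y = 0"
      using extreme_point_kernel_trivial s unfolding dual_vertices_def dual_poly_def by blast
    then show "v = 0"
      using ye by (simp add: vec_eq_iff)
  qed
  then have "invertible (transpose ?M)"
    unfolding invertible_left_inverse matrix_left_invertible_ker by blast
  then have "invertible (transpose (transpose ?M))"
    by (rule transpose_invertible)
  then show ?thesis
    by simp
qed

lemma vertex_policy_tight:
  fixes D :: "('x::finite, 'n1::finite, 'n2::finite, 'm::finite, 'p::finite, 't::finite) dro_data"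
  assumes "s \<in> dual_vertices D" and card: "card (supp s) = CARD('n2)" and "k \<in> supp s"
  shows "(Cmat D *v vertex_policy D x1 s \<xi>) $ k = dvec D x1 \<xi> $ k"
proof -
  let ?e = "row_list (supp s) :: 'n2 \<Rightarrow> 'm"
  let ?M = "(\<chi> i. Cmat D $ ?e i) :: real ^ 'n2 ^ 'n2"
  obtain i where i: "k = ?e i"
    using bij_betw_row_list[OF card] \<open>k \<in> supp s\<close> by (auto simp: bij_betw_def)
  have "(Cmat D *v vertex_policy D x1 s \<xi>) $ k = (?M *v vertex_policy D x1 s \<xi>) $ i"
    by (simp add: i matrix_vector_mult_def)
  also have "?M *v vertex_policy D x1 s \<xi> = (\<chi> i. dvec D x1 \<xi> $ ?e i)"
    using invertible_vertex_basis[OF assms(1,2)]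
    by (simp add: vertex_policy_def Let_def matrix_vector_mul_assoc matrix_inv_right_inverse)
  finally show ?thesis
    by (simp add: i)
qed

lemma vertex_policy_affine:
  fixes D :: "('x::finite, 'n1::finite, 'n2::finite, 'm::finite, 'p::finite, 't::finite) dro_data"
  shows
  "\<exists>Y y. \<forall>\<xi>. vertex_policy D x1 s \<xi> = Y *v \<xi> + y"
proof -
  let ?e = "row_list (supp s) :: 'n2 \<Rightarrow> 'm"
  let ?N = "matrix_inv (\<chi> i. Cmat D $ ?e i)"
  let ?q = "\<chi> i. (wvec D - Bmat D *v x1) $ ?e i"
  have "vertex_policy D x1 s \<xi> = (?N ** (\<chi> i. Wmat D $ ?e i)) *v \<xi> + ?N *v ?q" for \<xi>
  proof -
    have "(\<chi> i. dvec D x1 \<xi> $ ?e i) = (\<chi> i. Wmat D $ ?e i) *v \<xi> + ?q"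
      by (simp add: vec_eq_iff dvec_def matrix_vector_mult_def)
    then show ?thesis
      by (simp only: vertex_policy_def Let_def matrix_vector_right_distrib matrix_vector_mul_assoc)
  qed
  then show ?thesis
    by blast
qed

text \<open>Weak duality.\<close>

lemma dual_value_le_recourse:
  assumes "z \<in> dual_poly D"
  shows "ereal (dvec D x1 \<xi> \<bullet> z) \<le> recourse D x1 \<xi>"
  unfolding recourse_def
proof (rule INF_greatest)
  fix x2 assume "x2 \<in> {x2. Cmat D *v x2 \<ge> dvec D x1 \<xi>}"
  then have "dvec D x1 \<xi> \<bullet> z \<le> (Cmat D *v x2) \<bullet> z"
    using assms unfolding dual_poly_def inner_vec_def
    by (auto simp: less_eq_vec_def intro!: sum_mono mult_right_mono)
  also have "\<dots> = (z v* Cmat D) \<bullet> x2"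
    by (simp only: dot_lmul_matrix inner_commute[of _ z])
  also have "z v* Cmat D = bvec D"
    using assms by (simp add: dual_poly_def)
  finally show "ereal (dvec D x1 \<xi> \<bullet> z) \<le> ereal (bvec D \<bullet> x2)"
    by simp
qed

text \<open>
  Complementary slackness: the vertex vanishes on the constraints that its policy may leave slack,
  so primal and dual objective agree.
\<close>

lemma vertex_policy_optimal:
  fixes D :: "('x::finite, 'n1::finite, 'n2::finite, 'm::finite, 'p::finite, 't::finite) dro_data"
  assumes s: "s \<in> dual_vertices D" and card: "card (supp s) = CARD('n2)"
  shows "ereal (bvec D \<bullet> vertex_policy D x1 s \<xi>) \<le> recourse D x1 \<xi>"
proof -
  let ?x = "vertex_policy D x1 s \<xi>"
  have sZ: "s \<in> dual_poly D"
    using s by (simp add: dual_vertices_def extreme_point_of_def)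
  then have "bvec D \<bullet> ?x = (s v* Cmat D) \<bullet> ?x"
    by (simp add: dual_poly_def)
  also have "\<dots> = s \<bullet> (Cmat D *v ?x)"
    by (rule dot_lmul_matrix)
  also have "\<dots> = s \<bullet> dvec D x1 \<xi>"
    unfolding inner_vec_def
  proof (rule sum.cong)
    show "s $ k \<bullet> (Cmat D *v ?x) $ k = s $ k \<bullet> dvec D x1 \<xi> $ k" for k
      using vertex_policy_tight[OF s card] by (cases "s $ k = 0") (auto simp: supp_def)
  qed simp
  finally show ?thesis
    using dual_value_le_recourse[OF sZ] by (simp add: inner_commute)
qed

section \<open>Dominance cells and audits\<close>

lemma closed_dominance_halfspace: "closed {\<xi>. dvec D x1 \<xi> \<bullet> s \<ge> dvec D x1 \<xi> \<bullet> s'}"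
  unfolding dvec_def
  by (intro closed_Collect_le continuous_intros)

lemma cell_eq_Int: "cell D x1 T s = uset D \<inter> (\<Inter>s'\<in>T. {\<xi>. dvec D x1 \<xi> \<bullet> s \<ge> dvec D x1 \<xi> \<bullet> s'})"
  by (auto simp: cell_def)

lemma closedin_cell: "closedin (top_of_set (uset D)) (cell D x1 T s)"
  unfolding cell_eq_Int
  by (intro closedin_closed_Int closed_INT ballI closed_dominance_halfspace)

lemma compact_cell: "compact (uset D) \<Longrightarrow> compact (cell D x1 T s)"
  unfolding cell_eq_Int
  by (intro compact_Int_closed closed_INT ballI closed_dominance_halfspace)

lemma cells_cover:
  assumes "finite T" "T \<noteq> {}" "\<xi> \<in> uset D"
  shows "\<exists>s\<in>T. \<xi> \<in> cell D x1 T s"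
proof -
  let ?V = "(\<lambda>s. dvec D x1 \<xi> \<bullet> s) ` T"
  have "Max ?V \<in> ?V"
    using assms by (intro Max_in) auto
  then obtain s where "s \<in> T" "dvec D x1 \<xi> \<bullet> s = Max ?V"
    by auto
  moreover have "v \<le> Max ?V" if "v \<in> ?V" for v
    using \<open>finite T\<close> that by (intro Max_ge) simp_all
  ultimately have "\<xi> \<in> cell D x1 T s"
    using assms(3) by (simp add: cell_def)
  with \<open>s \<in> T\<close> show ?thesis
    by blast
qed

text \<open>
  The points outside the sets with nonempty interior form an open set covered by finitely many
  closed sets with empty interior.
\<close>

lemma finite_closed_cover_by_fat_sets:
  assumes "finite I" and closed: "\<And>i. i \<in> I \<Longrightarrow> closedin X (F i)"
    and cover: "topspace X \<subseteq> (\<Union>i\<in>I. F i)" and "x \<in> topspace X"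
  shows "\<exists>i\<in>I. X interior_of F i \<noteq> {} \<and> x \<in> F i"
proof (rule ccontr)
  let ?fat = "{i \<in> I. X interior_of F i \<noteq> {}}" and ?thin = "{i \<in> I. X interior_of F i = {}}"
  let ?U = "topspace X - (\<Union>i\<in>?fat. F i)"
  assume "\<not> ?thesis"
  with \<open>x \<in> topspace X\<close> have "x \<in> ?U"
    by blast
  have thin: "X interior_of (\<Union>i\<in>J. F i) = {}" if "finite J" "J \<subseteq> ?thin" for J
    using that
  proof (induction J)
    case (insert i J)
    then have "closedin X (F i)"
      using closed by blast
    with insert show ?case
      by (simp add: interior_of_union_eq_empty)
  qed simp
  have "openin X ?U"
  proof (intro openin_diff openin_topspace closedin_Union)
    show "finite (F ` ?fat)"
      using \<open>finite I\<close> by simp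
  qed (use closed in blast)
  moreover have "?U \<subseteq> (\<Union>i\<in>?thin. F i)"
  proof
    fix y assume y: "y \<in> ?U"
    then obtain i where "i \<in> I" "y \<in> F i"
      using cover by blast
    with y show "y \<in> (\<Union>i\<in>?thin. F i)"
      by blast
  qed
  ultimately have "?U \<subseteq> X interior_of (\<Union>i\<in>?thin. F i)"
    by (intro interior_of_maximal)
  moreover have "X interior_of (\<Union>i\<in>?thin. F i) = {}"
    using \<open>finite I\<close> by (intro thin) simp_all
  ultimately show False
    using \<open>x \<in> ?U\<close> by blast
qed

lemma pruned_cells_cover:
  assumes "finite T" "T \<noteq> {}" "\<xi> \<in> uset D"
  shows "\<exists>s\<in>epgv_prune D x1 T. \<xi> \<in> cell D x1 T s"
proof -
  have "\<exists>s\<in>T. (top_of_set (uset D)) interior_of (cell D x1 T s) \<noteq> {} \<and> \<xi> \<in> cell D x1 T s"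
    using assms cells_cover[OF assms(1,2)]
    by (intro finite_closed_cover_by_fat_sets closedin_cell) auto
  then show ?thesis
    by (auto simp: epgv_prune_def)
qed

text \<open>
  The audit is a supremum of reals; it bounds each violation because the violation is continuous
  and the cell compact.
\<close>

lemma violation_le_audit:
  assumes "compact (uset D)" "\<xi> \<in> cell D x1 T s"
  shows "violation D x1 s k \<xi> \<le> audit D x1 T s k"
  unfolding audit_def
proof (rule cSUP_upper[OF assms(2)])
  obtain Y y where "\<And>\<xi>. vertex_policy D x1 s \<xi> = Y *v \<xi> + y"
    using vertex_policy_affine by blast
  then have "continuous_on (cell D x1 T s) (violation D x1 s k)"
    unfolding violation_def dvec_def by (simp, intro continuous_intros)
  then show "bdd_above (violation D x1 s k ` cell D x1 T s)"
    by (intro bounded_imp_bdd_above compact_imp_bounded compact_continuous_image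
        compact_cell assms(1))
qed

lemma vertex_policy_feasible_on_cell:
  fixes D :: "('x::finite, 'n1::finite, 'n2::finite, 'm::finite, 'p::finite, 't::finite) dro_data"
  assumes "compact (uset D)" and "\<And>k. \<not> audit_fails D x1 0 T s k" and "s \<in> T"
    and "s \<in> dual_vertices D" "card (supp s) = CARD('n2)" and \<xi>: "\<xi> \<in> cell D x1 T s"
  shows "Cmat D *v vertex_policy D x1 s \<xi> \<ge> dvec D x1 \<xi>"
  unfolding less_eq_vec_def
proof
  fix k
  show "dvec D x1 \<xi> $ k \<le> (Cmat D *v vertex_policy D x1 s \<xi>) $ k"
  proof (cases "k \<in> supp s")
    case True
    then show ?thesis
      using vertex_policy_tight assms(4,5) by (metis order_refl)
  next
    case False
    then have "audit D x1 T s k \<le> 0"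
      using assms(2)[of k] \<open>s \<in> T\<close> \<xi> by (auto simp: audit_fails_def)
    then have "violation D x1 s k \<xi> \<le> 0"
      using violation_le_audit[OF assms(1) \<xi>] by (rule order_trans[rotated])
    then show ?thesis
      by (simp add: violation_def matrix_vector_mult_def inner_vec_def)
  qed
qed

section \<open>Runs of the two algorithms\<close>

lemma epgo_steps_dual_vertices:
  assumes "(epgo_step D \<epsilon>disc \<epsilon>obj)\<^sup>*\<^sup>* S T" "S \<subseteq> dual_vertices D"
  shows "T \<subseteq> dual_vertices D"
  using assms
  by induction (auto elim!: epgo_step.cases simp: separation_def)

lemma epgo_output_dual_vertices:
  assumes "epgo_output D \<epsilon>disc \<epsilon>obj x1 \<theta> Sobj"
  shows "Sobj \<subseteq> dual_vertices D"
proof -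
  obtain S1 T where T: "S1 \<subseteq> dual_vertices D" "(epgo_step D \<epsilon>disc \<epsilon>obj)\<^sup>*\<^sup>* S1 T"
    and del: "(epgo_delete D)\<^sup>*\<^sup>* T Sobj"
    using assms unfolding epgo_output_def by blast
  have "Sobj \<subseteq> T"
    using del by induction (auto elim!: epgo_delete.cases)
  with epgo_steps_dual_vertices[OF T(2,1)] show ?thesis
    by blast
qed

lemma epgv_steps_dual_vertices:
  assumes "(epgv_step D x1 \<epsilon>)\<^sup>*\<^sup>* S T" "S \<subseteq> dual_vertices D"
  shows "S \<subseteq> T \<and> T \<subseteq> dual_vertices D"
  using assms
  by induction (auto elim!: epgv_step.cases)

text \<open>
  The last master problem solved imposes only some of the constraints, so its optimal solution
  bounds the full master from below; a nonpositive exact separation value makes that solution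
  feasible for the full master.
\<close>

lemma epgo_certified_optimal:
  assumes "epgo_output D \<epsilon>disc 0 x1 \<theta> Sobj"
  shows "master_optimal D (dual_vertices D) (x1, \<theta>)"
proof -
  obtain S1 T V s where T: "S1 \<subseteq> dual_vertices D" "(epgo_step D \<epsilon>disc 0)\<^sup>*\<^sup>* S1 T"
    and opt: "master_optimal D T (x1, \<theta>)" and sep: "separation D (uset D) x1 \<theta> V s" and V: "V \<le> 0"
    using assms unfolding epgo_output_def by blast
  have "T \<subseteq> dual_vertices D"
    using epgo_steps_dual_vertices T by blast
  then have relax: "master_feasible D (dual_vertices D) \<subseteq> master_feasible D T"
    by (auto simp: master_feasible_def)
  have "phi D l \<theta> \<xi> \<ge> dvec D x1 \<xi> \<bullet> s'"
    if "\<xi> \<in> uset D" "s' \<in> dual_vertices D" "l \<in> {1..nphi D}" for \<xi> s' l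
  proof -
    have "s' \<in> dual_poly D"
      using that by (simp add: dual_vertices_def extreme_point_of_def)
    then have "dvec D x1 \<xi> \<bullet> s' - phi D l \<theta> \<xi> \<le> V"
      using sep that by (auto simp: separation_def)
    with V show ?thesis
      by simp
  qed
  then have "(x1, \<theta>) \<in> master_feasible D (dual_vertices D)"
    using opt by (auto simp: master_optimal_def is_arg_min_def master_feasible_def)
  with opt relax show ?thesis
    by (auto simp: master_optimal_def is_arg_min_def)
qed

section \<open>Comparison of the costs\<close>

lemma ereal_expectation_mono_AE:
  assumes "AE \<xi> in P. f \<xi> \<le> g \<xi>"
  shows "ereal_expectation P f \<le> ereal_expectation P g"
proof -
  have "(\<integral>\<^sup>+ \<xi>. e2ennreal (f \<xi>) \<partial>P) \<le> (\<integral>\<^sup>+ \<xi>. e2ennreal (g \<xi>) \<partial>P)"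
    "(\<integral>\<^sup>+ \<xi>. e2ennreal (- g \<xi>) \<partial>P) \<le> (\<integral>\<^sup>+ \<xi>. e2ennreal (- f \<xi>) \<partial>P)"
    using assms by (auto intro!: nn_integral_mono_AE e2ennreal_mono elim!: eventually_mono)
  then show ?thesis
    unfolding ereal_expectation_def by (intro ereal_minus_mono) (simp_all add: less_eq_ennreal.rep_eq)
qed

lemma recourse_le_recourse_K: "recourse D x1 \<xi> \<le> recourse_K D K x1 x2 \<xi>"
  unfolding recourse_def recourse_K_def
  by (rule INF_mono) auto

lemma two_stage_value_le_K_adapt_cost:
  assumes "(x1, x2) \<in> K_adapt_feasible D K"
  shows "two_stage_value D \<le> K_adapt_cost D K (x1, x2)"
proof -
  have "two_stage_value D \<le> two_stage_cost D x1"
    using assms by (auto simp: two_stage_value_def K_adapt_feasible_def intro: INF_lower)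
  also have "\<dots> \<le> K_adapt_cost D K (x1, x2)"
    unfolding two_stage_cost_def K_adapt_cost_def
    by (auto intro!: add_left_mono SUP_mono' ereal_expectation_mono_AE recourse_le_recourse_K)
  finally show ?thesis .
qed

text \<open>
  Only scenarios in \<open>\<Xi>\<close> matter, because the measures of the ambiguity set are carried by it.
\<close>

lemma K_adapt_cost_le_two_stage_cost:
  assumes "\<forall>P\<in>ambig D. prob_supported_on (uset D) P"
    and "\<And>\<xi>. \<xi> \<in> uset D \<Longrightarrow> recourse_K D K x1 x2 \<xi> \<le> recourse D x1 \<xi>"
  shows "K_adapt_cost D K (x1, x2) \<le> two_stage_cost D x1"
proof -
  have "ereal_expectation P (recourse_K D K x1 x2) \<le> ereal_expectation P (recourse D x1)"
    if "P \<in> ambig D" for P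
  proof (rule ereal_expectation_mono_AE)
    have "AE \<xi> in P. \<xi> \<in> uset D"
      using assms(1) that by (auto simp: prob_supported_on_def intro: prob_space.AE_prob_1)
    then show "AE \<xi> in P. recourse_K D K x1 x2 \<xi> \<le> recourse D x1 \<xi>"
      using assms(2) by (auto elim: eventually_mono)
  qed
  then show ?thesis
    unfolding two_stage_cost_def K_adapt_cost_def
    by (auto intro!: add_left_mono SUP_mono)
qed

text \<open>
  The vertices retained by EPG-V, numbered from 1, supply the rules. Beyond their count the numbering
  takes unspecified values; this does no harm, because the formula for the policy is affine at every
  vector and additional rules can only lower the minimum.
\<close>

lemma epgv_output_policies:
  fixes D :: "('x::finite, 'n1::finite, 'n2::finite, 'm::finite, 'p::finite, 't::finite) dro_data"
  assumes comp: "compact (uset D)"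
    and card: "\<forall>s\<in>dual_vertices D. card (supp s) = CARD('n2)"
    and S: "S \<subseteq> dual_vertices D" "S \<noteq> {}"
    and out: "epgv_output D x1 0 S Sval" and K: "card Sval \<le> K"
  obtains x2 where "\<And>k. affine_map_on (uset D) (x2 k)"
    and "\<And>\<xi>. \<xi> \<in> uset D \<Longrightarrow> recourse_K D K x1 x2 \<xi> \<le> recourse D x1 \<xi>"
proof -
  obtain T where run: "(epgv_step D x1 0)\<^sup>*\<^sup>* S T" and ok: "\<And>s k. \<not> audit_fails D x1 0 T s k"
    and Sval: "Sval = epgv_prune D x1 T"
    using out unfolding epgv_output_def by blast
  have T: "T \<noteq> {}" "T \<subseteq> dual_vertices D"
    using epgv_steps_dual_vertices[OF run S(1)] S(2) by auto
  then have "finite T"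
    using finite_dual_vertices finite_subset by blast
  then have "finite Sval"
    by (simp add: Sval epgv_prune_def)
  then obtain h where h: "bij_betw h {1..card Sval} Sval"
    using ex_bij_betw_nat_finite_1 by blast
  define x2 where "x2 k = vertex_policy D x1 (h k)" for k
  show ?thesis
  proof
    show "affine_map_on (uset D) (x2 k)" for k
      using vertex_policy_affine unfolding affine_map_on_def x2_def by blast
    fix \<xi> assume "\<xi> \<in> uset D"
    then obtain s where s: "s \<in> Sval" "\<xi> \<in> cell D x1 T s"
      using pruned_cells_cover[OF \<open>finite T\<close> T(1)] Sval by blast
    then have sT: "s \<in> T" "s \<in> dual_vertices D"
      using T by (auto simp: Sval epgv_prune_def)
    have "s \<in> h ` {1..card Sval}"
      using h s(1) by (simp add: bij_betw_def)
    then obtain k where k: "k \<in> {1..K}" "h k = s"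
      using K by force
    have "Cmat D *v x2 k \<xi> \<ge> dvec D x1 \<xi>"
      using vertex_policy_feasible_on_cell[OF comp ok sT _ s(2)] card sT by (simp add: x2_def k)
    then have "recourse_K D K x1 x2 \<xi> \<le> ereal (bvec D \<bullet> x2 k \<xi>)"
      unfolding recourse_K_def using k by (intro INF_lower) simp
    also have "\<dots> \<le> recourse D x1 \<xi>"
      using vertex_policy_optimal[OF sT(2)] card sT(2) by (simp add: x2_def k)
    finally show "recourse_K D K x1 x2 \<xi> \<le> recourse D x1 \<xi>" .
  qed
qed

theorem proposition3:
  fixes D :: "('x::finite, 'n1::finite, 'n2::finite, 'm::finite, 'p::finite, 't::finite) dro_data"
    and x1s :: "real ^ 'n1" and K :: nat
  assumes "compact (uset D)"
    and "\<forall>P\<in>ambig D. prob_supported_on (uset D) P"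
    and "CARD('m) \<ge> CARD('n2)"
    and "dual_poly D \<noteq> {}"
    and "\<exists>x1. two_stage_optimal D x1" and "\<bar>two_stage_value D\<bar> \<noteq> \<infinity>"
    and "exact_reformulation D"
    and "rank (Cmat D) = CARD('n2)"
    and "\<forall>s\<in>dual_vertices D. card (supp s) = CARD('n2)"
    and "\<forall>x1. affine_map_on (uset D) (dvec D x1)"
    and "polyhedron (uset D)"
    and "0 \<le> \<epsilon>disc" and "epgo_output D \<epsilon>disc 0 x1s \<theta>s Sobj"
    and "0 \<le> \<epsilon>disc'" and "0 \<le> \<epsilon>obj'" and "epgo_output D \<epsilon>disc' \<epsilon>obj' x1' \<theta>' S'" and "S' \<noteq> {}"
    and "epgv_output D x1s 0 S' Sval"
    and "K \<ge> card Sval"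
  shows "K_adapt_value D K = master_value D (dual_vertices D)
    \<and> (\<exists>x1 x2. K_adapt_optimal D K (x1, x2))"
proof -
  have "two_stage_optimal D x1s"
    using epgo_certified_optimal assms(7,13) unfolding exact_reformulation_def by blast
  then have x1s: "x1s \<in> first_stage D" and cost: "two_stage_cost D x1s \<le> two_stage_value D"
    by (auto simp: two_stage_optimal_def is_arg_min_linorder two_stage_value_def intro: INF_greatest)
  obtain x2 where x2: "\<And>k. affine_map_on (uset D) (x2 k)"
    and rec: "\<And>\<xi>. \<xi> \<in> uset D \<Longrightarrow> recourse_K D K x1s x2 \<xi> \<le> recourse D x1s \<xi>"
    using epgv_output_policies[OF assms(1,9) epgo_output_dual_vertices[OF assms(16)] assms(17-19)]
    by blast
  have feas: "(x1s, x2) \<in> K_adapt_feasible D K"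
    using x1s x2 by (simp add: K_adapt_feasible_def)
  have attained: "K_adapt_cost D K (x1s, x2) \<le> two_stage_value D"
    using K_adapt_cost_le_two_stage_cost[OF assms(2) rec] cost by (rule order_trans)
  have lower: "two_stage_value D \<le> K_adapt_cost D K y" if "y \<in> K_adapt_feasible D K" for y
    using two_stage_value_le_K_adapt_cost that by (cases y) auto
  have "K_adapt_optimal D K (x1s, x2)"
    using feas attained lower by (auto simp: K_adapt_optimal_def is_arg_min_linorder intro: order_trans)
  moreover have "K_adapt_value D K = two_stage_value D"
    unfolding K_adapt_value_def
    using feas attained lower by (intro antisym INF_greatest) (auto intro: INF_lower2)
  ultimately show ?thesis
    using assms(7) by (auto simp: exact_reformulation_def)
qed

end
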